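(* Let $q$ be a complex number with $|q|<1$ and let $k$ be a positive integer. Then, for each choice of sign (upper signs throughout, or lower signs throughout), \begin{align*} A_{k}^{\pm}(q)&=\frac{1}{(\pm q;q)_{\infty}^2}\sum_{i=0}^{\infty}\sum_{j=i+k}^{\infty}(\mp 1)^{j-i-k}\frac{j-i}{k}{j-i+k-1\choose 2k-1} \frac{q^{\frac{i(i+1)}{2}+\frac{j(j+1)}{2}}}{(q;q)_i(q;q)_j},\\ C_{k}^{\pm}(q)&=\frac{1}{(\pm q;q^2)_{\infty}^2}\sum_{i=0}^{\infty}\sum_{j=i+k}^{\infty}(\mp 1)^{j-i-k}\frac{j-i}{k}{j-i+k-1\choose 2k-1}\frac{ q^{i^2+j^2}}{(q^2;q^2)_i(q^2;q^2)_j}. \end{align*}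
   Context: The $q$-shifted factorial is $(a;q)_0=1$, $(a;q)_n=(1-a)(1-aq)\cdots(1-aq^{n-1})$ for $n\ge1$, and $(a;q)_\infty=\prod_{r=0}^{\infty}(1-aq^r)$. MacMahon's $q$-series are \[ A_k^{\pm}(q)=\sum_{1\le \lambda_1<\lambda_2<\cdots<\lambda_k}\frac{q^{\lambda_1+\lambda_2+\cdots+\lambda_k}}{(1\mp q^{\lambda_1})^2 (1\mp q^{\lambda_2})^2\cdots (1\mp q^{\lambda_k})^2}, \] \[ C_k^{\pm}(q)=\sum_{1\le \lambda_1<\lambda_2<\cdots<\lambda_k}\frac{q^{2\lambda_1+2\lambda_2+\cdots+2\lambda_k-k}}{(1\mp q^{2\lambda_1-1})^2 (1\mp q^{2\lambda_2-1})^2\cdots (1\mp q^{2\lambda_k-1})^2}, \] where the sums range over integers $\lambda_1,\dots,\lambda_k$. *)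

theory Defs
  imports "HOL-Analysis.Analysis"
begin

definition qpoch :: "complex \<Rightarrow> complex \<Rightarrow> nat \<Rightarrow> complex" where
  "qpoch a q n = (\<Prod>r<n. 1 - a * q ^ r)"

definition qpoch_inf :: "complex \<Rightarrow> complex \<Rightarrow> complex" where
  "qpoch_inf a q = (\<Prod>r. 1 - a * q ^ r)"

text \<open>The infinite product converges for every base inside the unit disc, and it does not
  vanish for the parameters that occur in denominators below.\<close>

lemma convergent_prod_qpoch:
  fixes a q :: complex
  assumes "norm q < 1"
  shows "convergent_prod (\<lambda>r. 1 - a * q ^ r)"
proof -
  have "summable (\<lambda>r. norm (a * q ^ r))"
    using assms by (simp add: norm_mult norm_power summable_mult summable_geometric)
  hence "abs_convergent_prod (\<lambda>r. 1 - a * q ^ r)"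
    by (simp add: abs_convergent_prod_conv_summable)
  thus ?thesis
    by (rule abs_convergent_prod_imp_convergent_prod)
qed

lemma qpoch_inf_nonzero:
  fixes a q :: complex
  assumes "norm q < 1" "norm a < 1"
  shows "qpoch_inf a q \<noteq> 0"
proof -
  have "1 - a * q ^ r \<noteq> 0" for r
  proof -
    have "norm (q ^ r) \<le> 1"
      using assms(1) by (simp add: norm_power power_le_one)
    hence "norm (a * q ^ r) \<le> norm a"
      by (simp add: norm_mult mult_left_le)
    with assms(2) have "norm (a * q ^ r) < 1" by linarith
    hence "a * q ^ r \<noteq> 1" by (metis less_irrefl norm_one)
    thus ?thesis by simp
  qed
  thus ?thesis
    unfolding qpoch_inf_def using convergent_prod_qpoch[OF assms(1)]
    by (simp add: prodinf_nonzero)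
qed

text \<open>The summation range \<open>1 \<le> \<lambda>\<^sub>1 < \<dots> < \<lambda>\<^sub>k\<close>; a tuple is encoded as the list of its entries.\<close>

definition increasing_tuples :: "nat \<Rightarrow> nat list set" where
  "increasing_tuples k = {ls. length ls = k \<and> sorted_wrt (<) ls \<and> (\<forall>l\<in>set ls. 1 \<le> l)}"

text \<open>The argument \<open>s\<close> is the sign in the superscript: \<open>s = 1\<close> gives the series with
  superscript \<open>+\<close> (denominators with \<open>1 - q\<^sup>\<lambda>\<close>), and \<open>s = -1\<close> the series with
  superscript \<open>-\<close> (denominators with \<open>1 + q\<^sup>\<lambda>\<close>).\<close>

definition macmahon_A_term :: "complex \<Rightarrow> complex \<Rightarrow> nat list \<Rightarrow> complex" where
  "macmahon_A_term s q ls = q ^ (\<Sum>l\<leftarrow>ls. l) / (\<Prod>l\<leftarrow>ls. (1 - s * q ^ l)\<^sup>2)"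

definition macmahon_A :: "complex \<Rightarrow> nat \<Rightarrow> complex \<Rightarrow> complex" where
  "macmahon_A s k q = (\<Sum>\<^sub>\<infinity>ls\<in>increasing_tuples k. macmahon_A_term s q ls)"

text \<open>The natural-number subtractions are exact, since all entries are at least 1.\<close>

definition macmahon_C_term :: "complex \<Rightarrow> complex \<Rightarrow> nat list \<Rightarrow> complex" where
  "macmahon_C_term s q ls =
     q ^ ((\<Sum>l\<leftarrow>ls. 2 * l) - length ls) / (\<Prod>l\<leftarrow>ls. (1 - s * q ^ (2 * l - 1))\<^sup>2)"

definition macmahon_C :: "complex \<Rightarrow> nat \<Rightarrow> complex \<Rightarrow> complex" where
  "macmahon_C s k q = (\<Sum>\<^sub>\<infinity>ls\<in>increasing_tuples k. macmahon_C_term s q ls)"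

end

theory Submission
  imports Defs "HOL-Computational_Algebra.Polynomial"
begin

text \<open>
  Both series have the shape \<open>\<Sum> \<Prod> a\<^sub>n / (1 - s a\<^sub>n)\<^sup>2\<close>, summed over the \<open>k\<close>-element sets of indices,
  with \<open>a\<^sub>n = b p\<^sup>n\<close>: for \<open>A\<close> take \<open>b = p = q\<close>, for \<open>C\<close> take \<open>b = q\<close> and \<open>p = q\<^sup>2\<close>. If \<open>x y = 1\<close> and
  \<open>z = x + y + 2 s\<close>, then \<open>(1 - s a)\<^sup>2 + z a = (1 + x a) (1 + y a)\<close>, so over \<open>n < N\<close> the product of
  the left-hand sides expands in powers of \<open>x\<close> and \<open>y\<close> with products \<open>e\<^sub>i e\<^sub>j\<close> of elementary
  symmetric polynomials as coefficients. Pairing \<open>(i, j)\<close> with \<open>(j, i)\<close> leaves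
  \<open>x\<^sup>n + y\<^sup>n\<close> with \<open>n = j - i\<close>, a Lucas-type polynomial in \<open>z\<close> whose coefficient at \<open>z\<^sup>k\<close> is the binomial
  factor of the theorem. Comparing coefficients of \<open>z\<^sup>k\<close> gives a finite identity; as \<open>N\<close> grows,
  \<open>e\<^sub>i\<close> tends to \<open>b\<^sup>i p\<^bsup>i(i-1)/2\<^esup> / (p;p)\<^sub>i\<close> by the \<open>q\<close>-binomial theorem, and dominated convergence applies
  since \<open>|e\<^sub>i| \<le> K / 4\<^sup>i\<close> uniformly in \<open>N\<close>.
\<close>

section \<open>Elementary symmetric polynomials and their limits for geometric sequences\<close>

definition esym :: "(nat \<Rightarrow> 'a::comm_semiring_1) \<Rightarrow> nat \<Rightarrow> nat \<Rightarrow> 'a" where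
  "esym f N i = (\<Sum>S | S \<subseteq> {..<N} \<and> card S = i. \<Prod>n\<in>S. f n)"

lemma esym_0_right [simp]: "esym f N 0 = 1"
proof -
  have "{S. S \<subseteq> {..<N} \<and> card S = 0} = {{}}"
    by (auto dest: finite_subset)
  then show ?thesis by (simp add: esym_def)
qed

lemma esym_eq_0: "N < i \<Longrightarrow> esym f N i = 0"
proof -
  assume "N < i"
  moreover have "card S \<le> N" if "S \<subseteq> {..<N}" for S
    using card_mono[OF finite_lessThan that] by simp
  ultimately have "{S. S \<subseteq> {..<N} \<and> card S = i} = {}"
    by (auto simp: not_le[symmetric])
  then show ?thesis unfolding esym_def by (simp only: sum.empty)
qed

lemma esym_Suc_Suc: "esym f (Suc N) (Suc i) = esym f N (Suc i) + f N * esym f N i"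
proof -
  let ?P = "\<lambda>(N::nat) i. {S. S \<subseteq> {..<N} \<and> card S = i}"
  have fin: "finite (?P N i)" for N i
    by (rule finite_subset[of _ "Pow {..<N}"]) auto
  have inj: "inj_on (insert N) (?P N i)"
    by (auto simp: inj_on_def)
  have split: "?P (Suc N) (Suc i) = ?P N (Suc i) \<union> insert N ` ?P N i"
  proof (intro equalityI subsetI)
    fix S assume S: "S \<in> ?P (Suc N) (Suc i)"
    then have "finite S" by (auto dest: finite_subset)
    show "S \<in> ?P N (Suc i) \<union> insert N ` ?P N i"
    proof (cases "N \<in> S")
      case True
      then have "S = insert N (S - {N})" "S - {N} \<in> ?P N i"
        using S \<open>finite S\<close> by (auto simp: lessThan_Suc)
      then show ?thesis by blast
    next
      case False
      then show ?thesis using S by (auto simp: lessThan_Suc)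
    qed
  next
    fix S assume "S \<in> ?P N (Suc i) \<union> insert N ` ?P N i"
    then show "S \<in> ?P (Suc N) (Suc i)"
    proof
      assume "S \<in> insert N ` ?P N i"
      then obtain T where T: "S = insert N T" "T \<subseteq> {..<N}" "card T = i" by auto
      then have "finite T" "N \<notin> T" by (auto dest: finite_subset)
      then show ?thesis using T by auto
    qed auto
  qed
  have disj: "?P N (Suc i) \<inter> insert N ` ?P N i = {}" by auto
  have "(\<Sum>S\<in>insert N ` ?P N i. prod f S) = (\<Sum>T\<in>?P N i. prod f (insert N T))"
    by (rule sum.reindex_cong[OF inj refl refl])
  also have "\<dots> = (\<Sum>T\<in>?P N i. f N * prod f T)"
  proof (rule sum.cong[OF refl])
    fix T assume "T \<in> ?P N i"
    then have "finite T" "N \<notin> T" by (auto dest: finite_subset)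
    then show "prod f (insert N T) = f N * prod f T" by simp
  qed
  finally show ?thesis
    unfolding esym_def split using fin disj
    by (subst sum.union_disjoint) (auto simp: sum_distrib_left)
qed

lemma prod_one_plus_eq_esym:
  "(\<Prod>n<N. 1 + x * f n) = (\<Sum>i\<le>N. x ^ i * esym f N i)"
proof -
  have "(\<Prod>n<N. 1 + x * f n) = (\<Sum>S\<in>Pow {..<N}. x ^ card S * prod f S)"
    by (subst add.commute, subst prod_add) (simp_all add: prod.distrib)
  also have "\<dots> = (\<Sum>i\<le>N. \<Sum>S | S \<in> Pow {..<N} \<and> card S = i. x ^ card S * prod f S)"
    by (rule sum.group[symmetric]) (use card_mono[of "{..<N}"] in fastforce)+
  also have "\<dots> = (\<Sum>i\<le>N. x ^ i * esym f N i)"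
    unfolding esym_def by (auto simp: sum_distrib_left intro!: sum.cong)
  finally show ?thesis .
qed

lemma norm_esym_le:
  fixes f :: "nat \<Rightarrow> 'a::{comm_semiring_1,real_normed_field}"
  shows "norm (esym f N i) \<le> esym (\<lambda>n. norm (f n)) N i"
  unfolding esym_def by (rule order_trans[OF norm_sum]) (simp add: prod_norm)

lemma esym_nonneg:
  fixes f :: "nat \<Rightarrow> real"
  assumes "\<And>n. f n \<ge> 0"
  shows "esym f N i \<ge> 0"
  unfolding esym_def by (intro sum_nonneg prod_nonneg assms)

text \<open>All terms of the generating function at \<open>R\<close> are nonnegative, so a single
  one is at most the whole product, which \<open>1 + t <= exp t\<close> bounds independently of
  \<open>N\<close>. The free \<open>R\<close> gives geometric decay in \<open>i\<close> at any
  rate.\<close>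

lemma esym_le_exp:
  fixes f :: "nat \<Rightarrow> real"
  assumes f: "\<And>n. f n \<ge> 0" and "summable f" and "R > 0"
  shows "esym f N i \<le> exp (R * suminf f) / R ^ i"
proof (cases "i \<le> N")
  case True
  have "R ^ i * esym f N i \<le> (\<Sum>j\<le>N. R ^ j * esym f N j)"
    using True assms by (intro member_le_sum) (auto simp: esym_nonneg)
  also have "\<dots> = (\<Prod>n<N. 1 + R * f n)"
    by (rule prod_one_plus_eq_esym[symmetric])
  also have "\<dots> \<le> exp (\<Sum>n<N. R * f n)"
    using assms by (intro prod_le_exp_sum) auto
  also have "\<dots> \<le> exp (R * suminf f)"
    using assms by (auto simp: sum_distrib_left[symmetric] intro!: sum_le_suminf)
  finally show ?thesis using \<open>R > 0\<close> by (simp add: field_simps)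
next
  case False
  then show ?thesis using \<open>R > 0\<close> by (simp add: esym_eq_0)
qed

text \<open>This is the finite \<open>q\<close>-binomial theorem, cross-multiplied so that it also
  holds when \<open>p\<close> is a root of unity. Induction on \<open>N\<close> uses the recurrence
  \<open>esym_Suc_Suc\<close>. For \<open>i > N\<close> the right-hand product contains the factor
  \<open>1 - p ^ 0\<close>, so both sides vanish.\<close>

lemma esym_geometric:
  fixes b p :: "'a::field"
  shows "esym (\<lambda>n. b * p ^ n) N i * (\<Prod>r<i. 1 - p ^ Suc r)
     = b ^ i * p ^ (i * (i - 1) div 2) * (\<Prod>r<i. 1 - p ^ (N - r))"
proof (induction N arbitrary: i)
  case 0
  show ?case
    by (cases i) (auto simp: esym_eq_0 lessThan_Suc_eq_insert_0)
next
  case (Suc N)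
  show ?case
  proof (cases i)
    case (Suc j)
    let ?e = "esym (\<lambda>n. b * p ^ n)" and ?t = "j * (j - 1) div 2"
    let ?D = "\<lambda>i. \<Prod>r<i. 1 - p ^ Suc r" and ?Q = "\<lambda>N i. \<Prod>r<i. 1 - p ^ (N - r)"
    have tri: "Suc j * (Suc j - 1) div 2 = ?t + j"
    proof -
      have "Suc j * (Suc j - 1) = j * (j - 1) + j * 2" by (cases j) auto
      then show ?thesis by simp
    qed
    have Q1: "?Q N (Suc j) = ?Q N j * (1 - p ^ (N - j))" by simp
    have Q2: "?Q (Suc N) (Suc j) = (1 - p ^ Suc N) * ?Q N j"
      by (subst prod.lessThan_Suc_shift) simp
    have "?e (Suc N) (Suc j) * ?D (Suc j)
       = ?e N (Suc j) * ?D (Suc j) + b * p ^ N * (?e N j * ?D j) * (1 - p ^ Suc j)"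
      by (simp add: esym_Suc_Suc algebra_simps)
    also have "\<dots> = b ^ Suc j * p ^ ?t * ?Q N j * (p ^ j * (1 - p ^ (N - j)) + p ^ N * (1 - p ^ Suc j))"
      unfolding Suc.IH tri Q1 by (simp add: power_add algebra_simps)
    also have "\<dots> = b ^ Suc j * p ^ ?t * ?Q N j * (p ^ j * (1 - p ^ Suc N))"
    proof (cases "j \<le> N")
      case True
      then have "p ^ j * p ^ (N - j) = p ^ N" by (simp flip: power_add)
      then have "p ^ j * (1 - p ^ (N - j)) + p ^ N * (1 - p ^ Suc j) = p ^ j * (1 - p ^ Suc N)"
        by (simp add: algebra_simps)
      then show ?thesis by simp
    next
      case False
      \<comment> \<open>Here \<open>N - j\<close> truncates to 0 and the exponent identity of the
        other case may fail, but the factor with \<open>r = N\<close> is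
        \<open>1 - p ^ 0 = 0\<close>.\<close>
      then have "?Q N j = 0" by (intro prod_zero) (auto intro!: bexI[of _ N])
      then show ?thesis by simp
    qed
    finally show ?thesis unfolding Suc tri Q2 by (simp add: power_add algebra_simps)
  qed simp
qed

lemma esym_geometric_tendsto:
  fixes b p :: complex
  assumes p: "norm p < 1"
  shows "(\<lambda>N. esym (\<lambda>n. b * p ^ n) N i)
    \<longlonglongrightarrow> b ^ i * p ^ (i * (i - 1) div 2) / qpoch p p i"
proof -
  have D: "(\<Prod>r<i. 1 - p ^ Suc r) = qpoch p p i" by (simp add: qpoch_def)
  have "1 - p * p ^ r \<noteq> 0" for r
  proof
    assume "1 - p * p ^ r = 0"
    then have "norm p * norm p ^ r = 1" by (simp flip: norm_power norm_mult)
    moreover have "norm p * norm p ^ r \<le> norm p"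
      using p by (intro mult_left_le) (auto simp: power_le_one)
    ultimately show False using p by linarith
  qed
  then have nz: "qpoch p p i \<noteq> 0" by (simp add: qpoch_def)
  \<comment> \<open>Shifting \<open>N\<close> by \<open>r\<close> removes the truncated subtraction;
    hence each of the finitely many factors tends to 1.\<close>
  have lim: "(\<lambda>N. p ^ (N - r)) \<longlonglongrightarrow> 0" for r
  proof (rule LIMSEQ_offset)
    show "(\<lambda>N. p ^ (N + r - r)) \<longlonglongrightarrow> 0" using p by (simp add: LIMSEQ_power_zero)
  qed
  have "(\<lambda>N. \<Prod>r<i. 1 - p ^ (N - r)) \<longlonglongrightarrow> (\<Prod>r<i. 1 - 0)"
    by (intro tendsto_prod tendsto_diff tendsto_const lim)
  then have "(\<lambda>N. b ^ i * p ^ (i * (i - 1) div 2) * (\<Prod>r<i. 1 - p ^ (N - r)) / qpoch p p i)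
      \<longlonglongrightarrow> b ^ i * p ^ (i * (i - 1) div 2) * (\<Prod>r<i. 1 - 0) / qpoch p p i"
    by (intro tendsto_divide tendsto_mult tendsto_const nz)
  moreover have "esym (\<lambda>n. b * p ^ n) N i
      = b ^ i * p ^ (i * (i - 1) div 2) * (\<Prod>r<i. 1 - p ^ (N - r)) / qpoch p p i" for N
    using esym_geometric[of b p N i] nz unfolding D by (simp add: field_simps)
  ultimately show ?thesis by simp
qed

section \<open>Lucas-type polynomials and their binomial coefficients\<close>

fun lucas_poly :: "complex \<Rightarrow> nat \<Rightarrow> complex poly" where
  "lucas_poly s 0 = [:2:]"
| "lucas_poly s (Suc 0) = [:- 2 * s, 1:]"
| "lucas_poly s (Suc (Suc n)) = [:- 2 * s, 1:] * lucas_poly s (Suc n) - lucas_poly s n"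

text \<open>When \<open>x * y = 1\<close>, the power sums \<open>x ^ n + y ^ n\<close> satisfy a
  three-term recurrence with multiplier \<open>x + y\<close>, which is the value of
  \<open>[:- 2 * s, 1:]\<close> at \<open>x + y + 2 * s\<close>.\<close>

lemma poly_lucas_poly:
  assumes "x * y = 1"
  shows "poly (lucas_poly s n) (x + y + 2 * s) = x ^ n + y ^ n"
proof (induction n rule: induct_nat_012)
  case 0
  show ?case by simp
next
  case 1
  show ?case by (simp add: algebra_simps)
next
  case (ge2 n)
  have "(x + y) * (x ^ Suc n + y ^ Suc n) - (x ^ n + y ^ n)
      = x ^ Suc (Suc n) + y ^ Suc (Suc n) + (x * y - 1) * (x ^ n + y ^ n)"
    by (simp add: algebra_simps)
  then show ?case using ge2 assms by (simp add: algebra_simps)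
qed

text \<open>Two uses of Pascal's rule: a second difference in the upper index lowers the lower index
  by two. The additive form avoids subtraction of naturals.\<close>

lemma binomial_second_difference:
  "(n + Suc k + 2 choose (2 * Suc k)) + (n + Suc k choose (2 * Suc k))
   = 2 * (n + Suc k + 1 choose (2 * Suc k)) + (n + k + 1 choose (2 * k))"
proof -
  have "2 * Suc k = Suc (Suc (2 * k))" by simp
  moreover have "n + Suc k + 2 = Suc (Suc (Suc (n + k)))" "n + Suc k = Suc (n + k)"
    "n + Suc k + 1 = Suc (Suc (n + k))" "n + k + 1 = Suc (n + k)"
    by simp_all
  ultimately show ?thesis by (simp only: binomial_Suc_Suc) simp
qed

text \<open>Since \<open>s^2 = 1\<close>, the signs in the recurrence for the coefficients factor
  out, leaving a second-difference equation for the integers. At \<open>n = k = 0\<close> the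
  truncated \<open>n + k - 1\<close> is 0, which yields the required constant 2.\<close>

lemma coeff_lucas_poly:
  assumes "s\<^sup>2 = 1"
  shows "coeff (lucas_poly s n) k
    = (- s) ^ (n + k) * of_nat ((n + k choose (2 * k)) + (n + k - 1 choose (2 * k)))"
proof (induction n arbitrary: k rule: induct_nat_012)
  case 0
  show ?case by (cases k) (auto simp: coeff_pCons binomial_eq_0)
next
  case 1
  show ?case
  proof (cases k)
    case (Suc j)
    then show ?thesis using assms by (cases j) (auto simp: coeff_pCons power2_eq_square binomial_eq_0 numeral_2_eq_2)
  qed (auto simp: coeff_pCons)
next
  case (ge2 n)
  let ?d = "\<lambda>n k. (n + k choose (2 * k)) + (n + k - 1 choose (2 * k))"
  have ss: "s * (s * x) = x" for x
    using assms by (simp add: power2_eq_square flip: mult.assoc)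
  show ?case
  proof (cases k)
    case 0
    have "coeff (lucas_poly s (Suc (Suc n))) 0
        = -2 * s * coeff (lucas_poly s (Suc n)) 0 - coeff (lucas_poly s n) 0"
      by simp
    then show ?thesis
      unfolding ge2 0 by (simp add: ss)
  next
    case (Suc j)
    \<comment> \<open>The two binomials in \<open>?d\<close> satisfy the second-difference rule
      separately, at \<open>n\<close> and at \<open>n - 1\<close>; hence the separate case
      \<open>n = 0\<close>.\<close>
    have nat: "?d (Suc (Suc n)) (Suc j) + ?d n (Suc j) = 2 * ?d (Suc n) (Suc j) + ?d (Suc n) j"
    proof (cases n)
      case 0
      then show ?thesis by (cases j) (auto simp: binomial_eq_0 numeral_2_eq_2)
    next
      case (Suc m)
      have add: "A + C + (B + D) = 2 * (E + F) + (G + H)"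
        if "A + B = 2 * E + G" "C + D = 2 * F + H" for A B C D E F G H :: nat
        using that by simp
      show ?thesis
        using add[OF binomial_second_difference[of n j] binomial_second_difference[of m j]]
        unfolding Suc
        by (simp only: add_Suc add_Suc_right diff_Suc_1 add_2_eq_Suc' Suc_eq_plus1[symmetric])
    qed
    have "coeff (lucas_poly s (Suc (Suc n))) (Suc j)
        = -2 * s * coeff (lucas_poly s (Suc n)) (Suc j) + coeff (lucas_poly s (Suc n)) j
          - coeff (lucas_poly s n) (Suc j)"
      by simp
    also have "\<dots> = (- s) ^ (n + Suc j) * (2 * of_nat (?d (Suc n) (Suc j))
         + of_nat (?d (Suc n) j) - of_nat (?d n (Suc j)))"
    proof -
      have "-2 * s * (- s) ^ (Suc n + Suc j) = 2 * (s\<^sup>2 * (- s) ^ (n + Suc j))"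
        by (simp add: power2_eq_square)
      then have "-2 * s * (- s) ^ (Suc n + Suc j) = 2 * (- s) ^ (n + Suc j)"
        by (simp only: assms mult_1)
      then have a: "-2 * s * ((- s) ^ (Suc n + Suc j) * x) = (- s) ^ (n + Suc j) * (2 * x)" for x
        by (simp only: mult.assoc[symmetric]) (simp only: mult_ac)
      have b: "(- s) ^ (Suc n + j) * x = (- s) ^ (n + Suc j) * x" for x by simp
      show ?thesis unfolding ge2 a b by (simp only: ring_distribs)
    qed
    also have "\<dots> = (- s) ^ (n + Suc j) * of_nat (?d (Suc (Suc n)) (Suc j))"
      using arg_cong[OF nat, of "of_nat :: nat \<Rightarrow> complex"] by (simp only: of_nat_add of_nat_mult of_nat_numeral) (simp add: algebra_simps)
    also have "(- s) ^ (n + Suc j) = (- s) ^ (Suc (Suc n) + Suc j)"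
      by (simp add: ss)
    finally show ?thesis unfolding Suc .
  qed
qed

text \<open>Absorption, \<open>2k C(n+k, 2k) = (n+k) C(n+k-1, 2k-1)\<close>, is combined with
  Pascal's rule. Doubling the claim and adding a common term keeps the computation within the
  naturals.\<close>

lemma binomial_sum_eq:
  assumes "k \<ge> 1"
  shows "k * ((n + k choose (2 * k)) + (n + k - 1 choose (2 * k))) = n * (n + k - 1 choose (2 * k - 1))"
proof -
  obtain j where k: "k = Suc j" using assms by (cases k) auto
  have a: "2 * k * (n + k choose (2 * k)) = (n + k) * (n + k - 1 choose (2 * k - 1))"
    unfolding k using Suc_times_binomial[of "2 * j + 1" "n + j"] by (simp add: mult.commute)
  have b: "(n + k choose (2 * k)) = (n + k - 1 choose (2 * k - 1)) + (n + k - 1 choose (2 * k))"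
    unfolding k by simp
  have "2 * (k * ((n + k choose (2 * k)) + (n + k - 1 choose (2 * k))))
      + 2 * k * (n + k - 1 choose (2 * k - 1)) = 2 * (2 * k * (n + k choose (2 * k)))"
    unfolding b by (simp add: algebra_simps)
  then have "2 * (k * ((n + k choose (2 * k)) + (n + k - 1 choose (2 * k))))
      + 2 * k * (n + k - 1 choose (2 * k - 1)) = 2 * ((n + k) * (n + k - 1 choose (2 * k - 1)))"
    unfolding a .
  then show ?thesis by (simp add: algebra_simps)
qed

text \<open>The weight of a pair \<open>(i, j)\<close> in the theorem depends only on
  \<open>n = j - i\<close>. For \<open>n < k\<close> the truncated exponent does no harm, as the
  binomial coefficient is 0.\<close>

definition pair_coeff :: "complex \<Rightarrow> nat \<Rightarrow> nat \<Rightarrow> complex" where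
  "pair_coeff s k n = (- s) ^ (n - k) * (of_nat n / of_nat k) * of_nat (n + k - 1 choose (2 * k - 1))"

text \<open>For \<open>k <= n\<close> the exponents \<open>n + k\<close> and \<open>n - k\<close>
  have the same parity, so the signs agree; for \<open>k > n\<close> the binomial coefficients on
  both sides vanish.\<close>

lemma coeff_lucas_poly_eq_pair_coeff:
  assumes s: "s = 1 \<or> s = -1" and "k \<ge> 1"
  shows "coeff (lucas_poly s n) k = pair_coeff s k n"
proof -
  let ?d = "(n + k choose (2 * k)) + (n + k - 1 choose (2 * k))"
  have s2: "s\<^sup>2 = 1" using s by auto
  have "of_nat k * (of_nat ?d :: complex) = of_nat n * of_nat (n + k - 1 choose (2 * k - 1))"
    unfolding of_nat_mult[symmetric] binomial_sum_eq[OF \<open>k \<ge> 1\<close>] ..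
  then have d: "of_nat ?d = of_nat n / of_nat k * (of_nat (n + k - 1 choose (2 * k - 1)) :: complex)"
    using \<open>k \<ge> 1\<close> by (simp add: field_simps)
  show ?thesis
  proof (cases "k \<le> n")
    case True
    then have "n + k = n - k + 2 * k" by simp
    then have "(- s) ^ (n + k) = (- s) ^ (n - k)"
      by (simp only: power_add power_mult power2_minus s2) simp
    then show ?thesis unfolding coeff_lucas_poly[OF s2] pair_coeff_def d by simp
  next
    case False
    then show ?thesis
      unfolding coeff_lucas_poly[OF s2] pair_coeff_def by (simp add: binomial_eq_0)
  qed
qed

text \<open>A crude exponential bound suffices, since the symmetric polynomials decay like
  \<open>1 / 4 ^ i\<close>.\<close>

lemma norm_pair_coeff_le:
  assumes s: "s = 1 \<or> s = -1" and "k \<ge> 1"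
  shows "norm (pair_coeff s k n) \<le> 2 * 2 ^ (n + k)"
proof -
  have s2: "s\<^sup>2 = 1" and ns: "norm s = 1" using s by auto
  have "(n + k choose (2 * k)) + (n + k - 1 choose (2 * k)) \<le> 2 ^ (n + k) + 2 ^ (n + k - 1)"
    by (intro add_mono binomial_le_pow2)
  also have "\<dots> \<le> 2 * 2 ^ (n + k)" by (simp add: power_increasing)
  finally have "real ((n + k choose (2 * k)) + (n + k - 1 choose (2 * k))) \<le> real (2 * 2 ^ (n + k))"
    unfolding of_nat_le_iff .
  then show ?thesis
    unfolding coeff_lucas_poly_eq_pair_coeff[OF assms, symmetric] coeff_lucas_poly[OF s2]
    by (simp add: norm_mult norm_power ns flip: of_nat_add)
qed

section \<open>The finite identity\<close>

lemma exists_reciprocal_pair: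
  fixes w :: complex
  obtains x y where "x + y = w" "x * y = 1"
proof
  \<comment> \<open>The witnesses are the two roots of \<open>t^2 - w * t + 1\<close>.\<close>
  let ?r = "csqrt (w\<^sup>2 / 4 - 1)"
  show "(w / 2 + ?r) + (w / 2 - ?r) = w" by simp
  have "(w / 2 + ?r) * (w / 2 - ?r) = w\<^sup>2 / 4 - ?r\<^sup>2"
    by (simp add: algebra_simps power2_eq_square)
  then show "(w / 2 + ?r) * (w / 2 - ?r) = 1" by simp
qed

text \<open>The square is cut along its diagonal, and the lower triangle is transposed onto the
  upper one.\<close>

lemma sum_square_symmetrize:
  fixes f :: "nat \<Rightarrow> nat \<Rightarrow> 'a::comm_monoid_add"
  shows "(\<Sum>i\<le>N. \<Sum>j\<le>N. f i j) = (\<Sum>i\<le>N. f i i) + (\<Sum>i\<le>N. \<Sum>j\<in>{i<..N}. f i j + f j i)"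
proof -
  have row: "(\<Sum>j\<le>N. f i j) = f i i + (\<Sum>j\<in>{i<..N}. f i j) + (\<Sum>j<i. f i j)" if "i \<le> N" for i
  proof -
    have "{..N} = insert i ({i<..N} \<union> {..<i})" using that by auto
    then have "(\<Sum>j\<le>N. f i j) = f i i + (\<Sum>j\<in>{i<..N} \<union> {..<i}. f i j)" by simp
    also have "(\<Sum>j\<in>{i<..N} \<union> {..<i}. f i j) = (\<Sum>j\<in>{i<..N}. f i j) + (\<Sum>j<i. f i j)"
      by (rule sum.union_disjoint) auto
    finally show ?thesis by (simp add: add.assoc)
  qed
  have "(\<Sum>i\<le>N. \<Sum>j<i. f i j) = (\<Sum>(i, j)\<in>(SIGMA i:{..N}. {..<i}). f i j)"
    by (simp add: sum.Sigma)
  also have "\<dots> = (\<Sum>(i, j)\<in>(SIGMA i:{..N}. {i<..N}). f j i)"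
    by (rule sum.reindex_bij_witness[of _ prod.swap prod.swap]) auto
  also have "\<dots> = (\<Sum>i\<le>N. \<Sum>j\<in>{i<..N}. f j i)"
    by (simp add: sum.Sigma)
  finally have swap: "(\<Sum>i\<le>N. \<Sum>j<i. f i j) = (\<Sum>i\<le>N. \<Sum>j\<in>{i<..N}. f j i)" .
  have "(\<Sum>i\<le>N. \<Sum>j\<le>N. f i j)
      = (\<Sum>i\<le>N. f i i + (\<Sum>j\<in>{i<..N}. f i j) + (\<Sum>j<i. f i j))"
    by (rule sum.cong) (simp_all add: row)
  also have "\<dots> = (\<Sum>i\<le>N. f i i) + (\<Sum>i\<le>N. \<Sum>j\<in>{i<..N}. f i j + f j i)"
    by (simp add: sum.distrib swap add.assoc)
  finally show ?thesis .
qed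

lemma finite_macmahon_identity:
  assumes s: "s = 1 \<or> s = -1" and "k \<ge> 1" and nz: "\<And>n. 1 - s * a n \<noteq> 0"
  shows "(\<Prod>n<N. (1 - s * a n)\<^sup>2) * esym (\<lambda>n. a n / (1 - s * a n)\<^sup>2) N k
    = (\<Sum>i\<le>N. \<Sum>j\<in>{i<..N}. pair_coeff s k (j - i) * (esym a N i * esym a N j))"
proof -
  let ?D = "\<Prod>n<N. (1 - s * a n)\<^sup>2" and ?g = "\<lambda>n. a n / (1 - s * a n)\<^sup>2" and ?e = "esym a N"
  \<comment> \<open>\<open>P\<close> and \<open>Q\<close> are two expansions in \<open>z\<close> of
    the product of \<open>(1 - s * a n)^2 + z * a n\<close>. The diagonal terms of \<open>Q\<close>
    are constants, so they do not reach the coefficient at \<open>k >= 1\<close>.\<close>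
  define P where "P = smult ?D (\<Sum>i\<le>N. monom (esym ?g N i) i)"
  define Q where "Q = (\<Sum>i\<le>N. [:?e i * ?e i:])
    + (\<Sum>i\<le>N. \<Sum>j\<in>{i<..N}. smult (?e i * ?e j) (lucas_poly s (j - i)))"
  have "poly P z = poly Q z" for z
  proof -
    \<comment> \<open>Every complex \<open>z\<close> has the form \<open>x + y + 2 * s\<close> with
      \<open>x * y = 1\<close>, so \<open>P\<close> and \<open>Q\<close> agree everywhere and hence
      as polynomials.\<close>
    obtain x y where xy: "x + y = z - 2 * s" "x * y = 1"
      by (rule exists_reciprocal_pair)
    then have z: "z = x + y + 2 * s" by simp
    have ss: "s * s = 1" using s by auto
    have "poly P z = ?D * (\<Prod>n<N. 1 + z * ?g n)"
      unfolding prod_one_plus_eq_esym by (simp add: P_def poly_sum poly_monom mult.commute)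
    also have "\<dots> = (\<Prod>n<N. (1 - s * a n)\<^sup>2 + z * a n)"
      unfolding prod.distrib[symmetric] using nz
      by (intro prod.cong) (auto simp: distrib_left)
    also have "\<dots> = (\<Prod>n<N. (1 + x * a n) * (1 + y * a n))"
    proof (rule prod.cong[OF refl])
      fix n
      have "(1 - s * a n)\<^sup>2 + z * a n - (1 + x * a n) * (1 + y * a n)
          = (s * s - x * y) * (a n)\<^sup>2"
        unfolding z by (simp add: algebra_simps power2_eq_square)
      then show "(1 - s * a n)\<^sup>2 + z * a n = (1 + x * a n) * (1 + y * a n)"
        using ss xy by simp
    qed
    also have "\<dots> = (\<Sum>i\<le>N. \<Sum>j\<le>N. x ^ i * ?e i * (y ^ j * ?e j))"
      by (simp only: prod.distrib prod_one_plus_eq_esym sum_product)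
    also have "\<dots> = (\<Sum>i\<le>N. x ^ i * ?e i * (y ^ i * ?e i))
        + (\<Sum>i\<le>N. \<Sum>j\<in>{i<..N}. x ^ i * ?e i * (y ^ j * ?e j) + x ^ j * ?e j * (y ^ i * ?e i))"
      by (rule sum_square_symmetrize)
    also have "\<dots> = poly Q z"
    proof -
      have 1: "x ^ i * ?e i * (y ^ i * ?e i) = ?e i * ?e i" for i
      proof -
        have "x ^ i * ?e i * (y ^ i * ?e i) = (x * y) ^ i * (?e i * ?e i)"
          by (simp only: power_mult_distrib mult_ac)
        then show ?thesis using xy by simp
      qed
      have 2: "x ^ i * ?e i * (y ^ j * ?e j) + x ^ j * ?e j * (y ^ i * ?e i)
          = ?e i * ?e j * poly (lucas_poly s (j - i)) z" if "i < j" for i j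
      proof -
        have j: "j = i + (j - i)" using that by simp
        have "x ^ i * y ^ j + x ^ j * y ^ i = (x * y) ^ i * (x ^ (j - i) + y ^ (j - i))"
          by (subst (1 2) j) (simp only: power_add power_mult_distrib algebra_simps)
        then have xy_sum: "x ^ i * y ^ j + x ^ j * y ^ i = poly (lucas_poly s (j - i)) z"
          unfolding z using poly_lucas_poly[OF xy(2)] xy(2) by simp
        then show ?thesis by (simp flip: xy_sum add: algebra_simps)
      qed
      show ?thesis
        unfolding Q_def by (simp add: poly_sum 1 2)
    qed
    finally show ?thesis .
  qed
  then have "P = Q" by (simp flip: poly_eq_poly_eq_iff add: fun_eq_iff)
  \<comment> \<open>This includes \<open>k > N\<close>, where both sides are 0.\<close>
  have "coeff P k = ?D * esym ?g N k"
    by (simp add: P_def coeff_sum esym_eq_0)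
  moreover have "coeff Q k = (\<Sum>i\<le>N. \<Sum>j\<in>{i<..N}. pair_coeff s k (j - i) * (?e i * ?e j))"
  proof -
    have "coeff [:c:] k = 0" for c :: complex
      using \<open>k \<ge> 1\<close> by (cases k) auto
    then show ?thesis
      by (simp add: Q_def coeff_sum coeff_lucas_poly_eq_pair_coeff[OF s \<open>k \<ge> 1\<close>] mult.commute)
  qed
  ultimately show ?thesis using \<open>P = Q\<close> by simp
qed

section \<open>Passage to the limit\<close>

lemma infsum_dominated_convergence:
  fixes f :: "nat \<Rightarrow> 'a \<Rightarrow> 'b::{banach, second_countable_topology}"
  assumes M: "M summable_on A"
    and bound: "\<And>N x. x \<in> A \<Longrightarrow> norm (f N x) \<le> M x"
    and lim: "\<And>x. x \<in> A \<Longrightarrow> (\<lambda>N. f N x) \<longlonglongrightarrow> g x"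
  shows "g summable_on A" "(\<lambda>N. infsum (f N) A) \<longlonglongrightarrow> infsum g A"
proof -
  have M0: "M x \<ge> 0" if "x \<in> A" for x
    using bound[OF that, of 0] by (rule order_trans[OF norm_ge_zero])
  have gM: "norm (g x) \<le> M x" if "x \<in> A" for x
    by (rule LIMSEQ_le_const2[OF tendsto_norm[OF lim[OF that]]]) (use bound that in auto)
  have "(\<lambda>x. norm (M x)) summable_on A"
    using M M0 by (subst summable_on_cong[of A _ M]) auto
  \<comment> \<open>\<open>infsetsum\<close> is an integral over the counting measure, so Lebesgue's
    theorem applies to it; absolute summability carries the result back to
    \<open>infsum\<close>.\<close>
  then have "integrable (count_space A) M"
    using abs_summable_equivalent[of M A] by (simp add: abs_summable_on_def)
  then have lim': "(\<lambda>N. infsetsum (f N) A) \<longlonglongrightarrow> infsetsum g A"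
    unfolding infsetsum_def using bound lim
    by (intro integral_dominated_convergence[where w = M]) (auto simp: AE_count_space)
  have f: "(\<lambda>x. norm (f N x)) summable_on A" for N
    by (rule Infinite_Sum.abs_summable_on_comparison_test'[OF M]) (rule bound)
  have g: "(\<lambda>x. norm (g x)) summable_on A"
    by (rule Infinite_Sum.abs_summable_on_comparison_test'[OF M]) (rule gM)
  then show "g summable_on A" by (rule abs_summable_summable)
  show "(\<lambda>N. infsum (f N) A) \<longlonglongrightarrow> infsum g A"
    using lim' f g by (simp add: abs_summable_equivalent infsetsum_infsum)
qed

text \<open>Any finite family of finite sets of naturals lies below some \<open>N\<close>, so the
  families of \<open>k\<close>-subsets of \<open>{..<N}\<close> are cofinal among the finite
  subfamilies. Absolute summability follows from \<open>esym_le_exp\<close> with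
  \<open>R = 1\<close>.\<close>

lemma esym_tendsto_infsum:
  fixes g :: "nat \<Rightarrow> complex"
  assumes "summable (\<lambda>n. norm (g n))"
  shows "(\<lambda>S. \<Prod>n\<in>S. g n) summable_on {S. finite S \<and> card S = k}" (is "?f summable_on ?A")
    and "(\<lambda>N. esym g N k) \<longlonglongrightarrow> (\<Sum>\<^sub>\<infinity>S\<in>{S. finite S \<and> card S = k}. \<Prod>n\<in>S. g n)"
proof -
  let ?B = "\<lambda>N. {S. S \<subseteq> {..<N} \<and> card S = k}"
  have finB: "finite (?B N)" for N :: nat
    by (rule finite_subset[of _ "Pow {..<N}"]) auto
  have BA: "?B N \<subseteq> ?A" for N by (auto dest: finite_subset)
  have ev: "\<exists>N. F \<subseteq> ?B N" if F: "finite F" "F \<subseteq> ?A" for F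
  proof -
    have "finite (\<Union>F)" using F by auto
    then obtain N where "\<Union>F \<subseteq> {..<N}" using finite_nat_iff_bounded by blast
    then show ?thesis using F by blast
  qed
  have "(\<lambda>S. norm (?f S)) summable_on ?A"
  proof (rule nonneg_bdd_above_summable_on)
    show "bdd_above (sum (\<lambda>S. norm (?f S)) ` {F. F \<subseteq> ?A \<and> finite F})"
    proof (rule bdd_aboveI2)
      fix F assume F: "F \<in> {F. F \<subseteq> ?A \<and> finite F}"
      then obtain N where N: "F \<subseteq> ?B N" using ev by blast
      have "(\<Sum>S\<in>F. norm (?f S)) \<le> (\<Sum>S\<in>?B N. norm (?f S))"
        by (rule sum_mono2[OF finB N]) auto
      also have "\<dots> = esym (\<lambda>n. norm (g n)) N k"
        by (simp add: esym_def prod_norm)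
      also have "\<dots> \<le> exp (1 * (\<Sum>n. norm (g n))) / 1 ^ k"
        by (rule esym_le_exp) (use assms in auto)
      finally show "(\<Sum>S\<in>F. norm (?f S)) \<le> exp (1 * (\<Sum>n. norm (g n))) / 1 ^ k" .
    qed
  qed auto
  then show sm: "?f summable_on ?A" by (rule abs_summable_summable)
  have "filterlim ?B (finite_subsets_at_top ?A) sequentially"
    unfolding filterlim_finite_subsets_at_top
  proof (intro allI impI)
    fix F assume F: "finite F \<and> F \<subseteq> ?A"
    then obtain N where N: "F \<subseteq> ?B N" using ev by blast
    have "F \<subseteq> ?B M" if "M \<ge> N" for M using N that by fastforce
    then show "eventually (\<lambda>M. finite (?B M) \<and> F \<subseteq> ?B M \<and> ?B M \<subseteq> ?A) sequentially"
      using finB BA by (auto simp: eventually_sequentially)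
  qed
  from filterlim_compose[OF infsum_tendsto[OF sm] this]
  show "(\<lambda>N. esym g N k) \<longlonglongrightarrow> infsum ?f ?A"
    by (simp add: esym_def)
qed

lemma summable_on_geometric_prod:
  fixes c :: real
  assumes "0 \<le> c" "c < 1"
  shows "(\<lambda>(i::nat, j::nat). K * c ^ i * c ^ j) summable_on UNIV"
proof -
  have geo: "((\<lambda>j. c ^ j) has_sum (1 / (1 - c))) (UNIV :: nat set)"
    using assms by (intro norm_summable_imp_has_sum geometric_sums) (auto simp: summable_geometric)
  have "(\<lambda>(i::nat, j::nat). c ^ i * c ^ j) summable_on UNIV \<times> UNIV"
  proof (rule summable_on_SigmaI)
    show "((\<lambda>j. case (i, j) of (i, j) \<Rightarrow> c ^ i * c ^ j) has_sum (c ^ i * (1 / (1 - c)))) UNIV" for i :: nat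
      unfolding prod.case by (rule has_sum_cmult_right[OF geo])
    show "(\<lambda>i. c ^ i * (1 / (1 - c))) summable_on (UNIV :: nat set)"
      by (rule summable_on_cmult_left) (use geo in \<open>auto simp: summable_on_def\<close>)
  qed (use assms in auto)
  then have "(\<lambda>x. K * (case x of (i::nat, j::nat) \<Rightarrow> c ^ i * c ^ j)) summable_on UNIV \<times> UNIV"
    by (rule summable_on_cmult_right)
  then show ?thesis by (simp add: case_prod_unfold mult.assoc)
qed

lemma pair_coeff_eq_0: "n < k \<Longrightarrow> pair_coeff s k n = 0"
  by (simp add: pair_coeff_def binomial_eq_0)

text \<open>Both sides of \<open>finite_macmahon_identity\<close> converge, the right one by
  dominated convergence, and uniqueness of limits equates them. The uniform bound
  \<open>r < 1\<close> keeps the denominators away from 0.\<close>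

lemma macmahon_identity_of_esym_limits:
  fixes a :: "nat \<Rightarrow> complex"
  assumes s: "s = 1 \<or> s = -1" and "k \<ge> 1"
    and a: "summable (\<lambda>n. norm (a n))" and r: "\<And>n. norm (a n) \<le> r" "r < 1"
    and E: "\<And>i. (\<lambda>N. esym a N i) \<longlonglongrightarrow> E i"
    and D: "(\<lambda>N. \<Prod>n<N. 1 - s * a n) \<longlonglongrightarrow> D" "D \<noteq> 0"
  shows "(\<lambda>S. \<Prod>n\<in>S. a n / (1 - s * a n)\<^sup>2) summable_on {S. finite S \<and> card S = k}"
    and "(\<lambda>(i, j). pair_coeff s k (j - i) * (E i * E j)) summable_on (SIGMA i:UNIV. {i + k..})"
    and "(\<Sum>\<^sub>\<infinity>S\<in>{S. finite S \<and> card S = k}. \<Prod>n\<in>S. a n / (1 - s * a n)\<^sup>2)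
      = 1 / D\<^sup>2 * (\<Sum>\<^sub>\<infinity>i. \<Sum>\<^sub>\<infinity>j\<in>{i + k..}. pair_coeff s k (j - i) * (E i * E j))"
proof -
  let ?g = "\<lambda>n. a n / (1 - s * a n)\<^sup>2" and ?A = "{S. finite S \<and> card S = k}"
    and ?I = "SIGMA i:UNIV. {i + k..}"
  have ns: "norm s = 1" using s by auto
  have ge: "norm (1 - s * a n) \<ge> 1 - r" for n
    using norm_triangle_ineq2[of 1 "s * a n"] r(1)[of n] by (simp add: norm_mult ns)
  then have nz: "1 - s * a n \<noteq> 0" for n
    using r(2) by (metis diff_gt_0_iff_gt norm_zero not_le)
  have g: "summable (\<lambda>n. norm (?g n))"
  proof (rule summable_comparison_test')
    show "summable (\<lambda>n. norm (a n) * (1 / (1 - r)\<^sup>2))"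
      using a by (rule summable_mult2)
    fix n :: nat
    have "(1 - r)\<^sup>2 \<le> (norm (1 - s * a n))\<^sup>2"
      using ge r(2) by (intro power_mono) auto
    then have "norm (a n) / (norm (1 - s * a n))\<^sup>2 \<le> norm (a n) / (1 - r)\<^sup>2"
      using r(2) nz by (intro divide_left_mono mult_pos_pos) auto
    then show "norm (norm (?g n)) \<le> norm (a n) * (1 / (1 - r)\<^sup>2)"
      by (simp add: norm_divide norm_power)
  qed
  show "(\<lambda>S. prod ?g S) summable_on ?A" by (rule esym_tendsto_infsum[OF g])
  have "(\<lambda>N. (\<Prod>n<N. 1 - s * a n)\<^sup>2 * esym ?g N k) \<longlonglongrightarrow> D\<^sup>2 * infsum (prod ?g) ?A"
    by (intro tendsto_intros D esym_tendsto_infsum[OF g])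
  then have lhs: "(\<lambda>N. (\<Prod>n<N. (1 - s * a n)\<^sup>2) * esym ?g N k) \<longlonglongrightarrow> D\<^sup>2 * infsum (prod ?g) ?A"
    by (simp add: prod_power_distrib)

  define f where "f N = (\<lambda>(i, j). pair_coeff s k (j - i) * (esym a N i * esym a N j))" for N
  \<comment> \<open>\<open>K\<close> comes from \<open>esym_le_exp\<close> with
    \<open>R = 4\<close>. As \<open>2 ^ (j - i + k) <= 2 ^ i * 2 ^ j * 2 ^ k\<close>, the factor
    \<open>1 / (4 ^ i * 4 ^ j)\<close> leaves the summable majorant \<open>M\<close>.\<close>
  define K where "K = exp (4 * (\<Sum>n. norm (a n)))"
  define M where "M = (\<lambda>(i::nat, j::nat). (2 * 2 ^ k * (K * K)) * (1/2) ^ i * (1/2) ^ j :: real)"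
  have e: "norm (esym a N i) \<le> K / 4 ^ i" for N i
    unfolding K_def by (rule order_trans[OF norm_esym_le esym_le_exp]) (use a in auto)
  have M: "M summable_on ?I"
    unfolding M_def
    by (rule summable_on_subset_banach[OF summable_on_geometric_prod]) auto
  have fM: "norm (f N x) \<le> M x" if "x \<in> ?I" for N x
  proof -
    obtain i j where x: "x = (i, j)" by (cases x)
    have "K > 0" by (simp add: K_def)
    have "norm (f N x) \<le> (2 * 2 ^ (j - i + k)) * (K / 4 ^ i * (K / 4 ^ j))"
      unfolding f_def x prod.case norm_mult
      by (intro mult_mono norm_pair_coeff_le[OF s \<open>k \<ge> 1\<close>] e) (use \<open>K > 0\<close> in auto)
    also have "\<dots> \<le> (2 * (2 ^ i * 2 ^ j * 2 ^ k)) * (K / 4 ^ i * (K / 4 ^ j))"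
      using \<open>K > 0\<close>
      by (intro mult_right_mono) (auto simp flip: power_add intro!: power_increasing)
    also have "\<dots> = M x"
    proof -
      have "(4::real) ^ n = 2 ^ n * 2 ^ n" for n by (simp flip: power_mult_distrib)
      then show ?thesis unfolding x M_def by (simp add: field_simps)
    qed
    finally show ?thesis .
  qed
  have lim: "(\<lambda>N. f N x) \<longlonglongrightarrow> (case x of (i, j) \<Rightarrow> pair_coeff s k (j - i) * (E i * E j))" for x
    unfolding f_def case_prod_unfold by (intro tendsto_intros E)
  note dc = infsum_dominated_convergence[OF M fM lim]
  show sum: "(\<lambda>(i, j). pair_coeff s k (j - i) * (E i * E j)) summable_on ?I"
    by (rule dc(1))
  have "infsum (f N) ?I = (\<Prod>n<N. (1 - s * a n)\<^sup>2) * esym ?g N k" for N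
  proof -
    \<comment> \<open>The two index sets differ only by zero terms: \<open>esym_eq_0\<close> covers
      \<open>j > N\<close>, and \<open>pair_coeff_eq_0\<close> covers
      \<open>j < i + k\<close>.\<close>
    have "infsum (f N) ?I = infsum (f N) (SIGMA i:{..N}. {i<..N})"
      by (rule infsum_cong_neutral)
        (use \<open>k \<ge> 1\<close> in \<open>auto simp: f_def esym_eq_0 intro!: pair_coeff_eq_0\<close>)
    also have "\<dots> = (\<Sum>i\<le>N. \<Sum>j\<in>{i<..N}. pair_coeff s k (j - i) * (esym a N i * esym a N j))"
      by (simp add: f_def sum.Sigma)
    finally show ?thesis
      using finite_macmahon_identity[OF s \<open>k \<ge> 1\<close> nz] by simp
  qed
  with dc(2) have "(\<lambda>N. (\<Prod>n<N. (1 - s * a n)\<^sup>2) * esym ?g N k)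
      \<longlonglongrightarrow> (\<Sum>\<^sub>\<infinity>(i, j)\<in>?I. pair_coeff s k (j - i) * (E i * E j))"
    by simp
  from LIMSEQ_unique[OF lhs this] D(2)
  have "infsum (prod ?g) ?A = 1 / D\<^sup>2 * (\<Sum>\<^sub>\<infinity>(i, j)\<in>?I. pair_coeff s k (j - i) * (E i * E j))"
    by (simp add: field_simps)
  also have "(\<Sum>\<^sub>\<infinity>(i, j)\<in>?I. pair_coeff s k (j - i) * (E i * E j))
      = (\<Sum>\<^sub>\<infinity>i. \<Sum>\<^sub>\<infinity>j\<in>{i + k..}. pair_coeff s k (j - i) * (E i * E j))"
    by (rule infsum_Sigma'_banach[OF sum, symmetric])
  finally show "infsum (prod ?g) ?A
      = 1 / D\<^sup>2 * (\<Sum>\<^sub>\<infinity>i. \<Sum>\<^sub>\<infinity>j\<in>{i + k..}. pair_coeff s k (j - i) * (E i * E j))" .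
qed

text \<open>The case \<open>a n = b * p ^ n\<close>, with \<open>r = norm b\<close>. The infinite
  product is nonzero because \<open>norm (s * b) < 1\<close>.\<close>

lemma macmahon_geometric:
  fixes b p s :: complex
  assumes s: "s = 1 \<or> s = -1" and "k \<ge> 1" and b: "norm b < 1" and p: "norm p < 1"
  defines "E \<equiv> \<lambda>i. b ^ i * p ^ (i * (i - 1) div 2) / qpoch p p i"
  shows "(\<lambda>S. \<Prod>n\<in>S. b * p ^ n / (1 - s * (b * p ^ n))\<^sup>2) summable_on {S. finite S \<and> card S = k}"
    and "(\<lambda>(i, j). pair_coeff s k (j - i) * (E i * E j)) summable_on (SIGMA i:UNIV. {i + k..})"
    and "(\<Sum>\<^sub>\<infinity>S\<in>{S. finite S \<and> card S = k}. \<Prod>n\<in>S. b * p ^ n / (1 - s * (b * p ^ n))\<^sup>2)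
      = 1 / (qpoch_inf (s * b) p)\<^sup>2
        * (\<Sum>\<^sub>\<infinity>i. \<Sum>\<^sub>\<infinity>j\<in>{i + k..}. pair_coeff s k (j - i) * (E i * E j))"
proof -
  have 1: "summable (\<lambda>n. norm (b * p ^ n))"
    using p by (simp add: norm_mult norm_power summable_mult summable_geometric)
  have 2: "norm (b * p ^ n) \<le> norm b" for n
    using p by (simp add: norm_mult norm_power mult_left_le power_le_one)
  have 3: "(\<lambda>N. \<Prod>n<N. 1 - s * (b * p ^ n)) \<longlonglongrightarrow> qpoch_inf (s * b) p"
    using convergent_prod_qpoch[OF p, of "s * b"]
    unfolding qpoch_inf_def convergent_prod_has_prod_iff
    by (auto simp: mult.assoc dest: has_prod_imp_tendsto')
  have 4: "qpoch_inf (s * b) p \<noteq> 0"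
    using s b by (intro qpoch_inf_nonzero[OF p]) auto
  note * = macmahon_identity_of_esym_limits[OF s \<open>k \<ge> 1\<close> 1 2 b esym_geometric_tendsto[OF p] 3 4]
  show "(\<lambda>S. \<Prod>n\<in>S. b * p ^ n / (1 - s * (b * p ^ n))\<^sup>2) summable_on {S. finite S \<and> card S = k}"
    "(\<lambda>(i, j). pair_coeff s k (j - i) * (E i * E j)) summable_on (SIGMA i:UNIV. {i + k..})"
    "(\<Sum>\<^sub>\<infinity>S\<in>{S. finite S \<and> card S = k}. \<Prod>n\<in>S. b * p ^ n / (1 - s * (b * p ^ n))\<^sup>2)
      = 1 / (qpoch_inf (s * b) p)\<^sup>2
        * (\<Sum>\<^sub>\<infinity>i. \<Sum>\<^sub>\<infinity>j\<in>{i + k..}. pair_coeff s k (j - i) * (E i * E j))"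
    unfolding E_def by (fact *)+
qed

section \<open>From finite sets to increasing tuples, and the two series\<close>

lemma increasing_tuples_eq_image:
  "increasing_tuples k = (\<lambda>S. map Suc (sorted_list_of_set S)) ` {S. finite S \<and> card S = k}"
proof (intro equalityI subsetI)
  fix ls assume "ls \<in> increasing_tuples k"
  then have ls: "length ls = k" "sorted_wrt (<) ls" "\<forall>l\<in>set ls. 1 \<le> l"
    by (auto simp: increasing_tuples_def)
  define ms where "ms = map (\<lambda>l. l - 1) ls"
  \<comment> \<open>Sets are indexed from 0 and tuples from 1; \<open>Suc\<close> undoes the
    subtraction because all entries are positive.\<close>
  have map: "map Suc ms = ls"
    unfolding ms_def map_map using ls(3) by (intro map_idI) auto
  have ms: "sorted_wrt (<) ms"
    using ls(2) unfolding map[symmetric] sorted_wrt_map by simp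
  then have "sorted_list_of_set (set ms) = ms"
    by (simp add: strict_sorted_iff sorted_list_of_set.idem_if_sorted_distinct)
  moreover have "card (set ms) = k"
    using ms ls(1) distinct_card[of ms] by (simp add: strict_sorted_iff ms_def)
  ultimately show "ls \<in> (\<lambda>S. map Suc (sorted_list_of_set S)) ` {S. finite S \<and> card S = k}"
    using map by (intro image_eqI[of _ _ "set ms"]) auto
qed (auto simp: increasing_tuples_def sorted_wrt_map)

lemma inj_on_sorted_tuple:
  "inj_on (\<lambda>S. map Suc (sorted_list_of_set S)) {S. finite S \<and> card S = k}"
  by (rule inj_onI) (metis (mono_tags, lifting) inj_map_eq_map inj_Suc mem_Collect_eq set_sorted_list_of_set)

lemma infsum_increasing_tuples:
  fixes T :: "nat list \<Rightarrow> complex"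
  assumes T: "\<And>ms. T (map Suc ms) = (\<Prod>n\<leftarrow>ms. g n)"
  shows "T summable_on increasing_tuples k
      \<longleftrightarrow> (\<lambda>S. \<Prod>n\<in>S. g n) summable_on {S. finite S \<and> card S = k}"
    and "infsum T (increasing_tuples k) = (\<Sum>\<^sub>\<infinity>S\<in>{S. finite S \<and> card S = k}. \<Prod>n\<in>S. g n)"
proof -
  have "T (map Suc (sorted_list_of_set S)) = (\<Prod>n\<in>S. g n)" if "finite S" for S
    using that prod.distinct_set_conv_list[of "sorted_list_of_set S" g] by (simp add: T)
  then show "T summable_on increasing_tuples k
      \<longleftrightarrow> (\<lambda>S. \<Prod>n\<in>S. g n) summable_on {S. finite S \<and> card S = k}"
    "infsum T (increasing_tuples k) = (\<Sum>\<^sub>\<infinity>S\<in>{S. finite S \<and> card S = k}. \<Prod>n\<in>S. g n)"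
    unfolding increasing_tuples_eq_image summable_on_reindex[OF inj_on_sorted_tuple]
      infsum_reindex[OF inj_on_sorted_tuple]
    by (auto intro!: summable_on_cong infsum_cong)
qed

lemma macmahon_A_term_eq_prod_list:
  "macmahon_A_term s q (map Suc ms) = (\<Prod>n\<leftarrow>ms. q * q ^ n / (1 - s * (q * q ^ n))\<^sup>2)"
proof (induction ms)
  case (Cons m ms)
  have "macmahon_A_term s q (map Suc (m # ms))
      = q * q ^ m / (1 - s * (q * q ^ m))\<^sup>2 * macmahon_A_term s q (map Suc ms)"
    by (simp add: macmahon_A_term_def power_add)
  then show ?case using Cons by simp
qed (simp add: macmahon_A_term_def)

lemma macmahon_C_term_eq_prod_list:
  "macmahon_C_term s q (map Suc ms) = (\<Prod>n\<leftarrow>ms. q * (q\<^sup>2) ^ n / (1 - s * (q * (q\<^sup>2) ^ n))\<^sup>2)"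
proof (induction ms)
  case (Cons m ms)
  \<comment> \<open>The truncated exponent splits off \<open>2 * m + 1\<close> because the remaining
    sum is at least the remaining length.\<close>
  have "L \<le> S \<Longrightarrow> 2 * Suc m + S - Suc L = Suc (2 * m) + (S - L)" for L S by arith
  moreover have "length ms \<le> (\<Sum>x\<leftarrow>ms. 2 * Suc x)" by (induction ms) auto
  ultimately have "2 * Suc m + (\<Sum>x\<leftarrow>ms. 2 * Suc x) - Suc (length ms)
      = Suc (2 * m) + ((\<Sum>x\<leftarrow>ms. 2 * Suc x) - length ms)"
    by blast
  then have "q ^ (2 * Suc m + (\<Sum>x\<leftarrow>ms. 2 * Suc x) - Suc (length ms))
      = q * (q\<^sup>2) ^ m * q ^ ((\<Sum>x\<leftarrow>ms. 2 * Suc x) - length ms)"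
    by (simp only: power_add power_Suc power_mult)
  then have "macmahon_C_term s q (map Suc (m # ms))
      = q * (q\<^sup>2) ^ m / (1 - s * (q * (q\<^sup>2) ^ m))\<^sup>2 * macmahon_C_term s q (map Suc ms)"
    by (simp add: macmahon_C_term_def o_def power_mult)
  then show ?case using Cons by simp
qed (simp add: macmahon_C_term_def)

theorem theorem2p2:
  fixes q s :: complex and k :: nat
  assumes "norm q < 1" and "k \<ge> 1" and "s = 1 \<or> s = -1"
  shows
    "macmahon_A_term s q summable_on increasing_tuples k \<and>
     (\<lambda>(i, j). (-s) ^ (j - i - k) * (of_nat (j - i) / of_nat k)
          * of_nat ((j - i + k - 1) choose (2 * k - 1))
          * (q ^ (i * (i + 1) div 2 + j * (j + 1) div 2) / (qpoch q q i * qpoch q q j)))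
       summable_on (SIGMA i:UNIV. {i + k..}) \<and>
     macmahon_A s k q = 1 / (qpoch_inf (s * q) q)\<^sup>2 *
       (\<Sum>\<^sub>\<infinity>i. \<Sum>\<^sub>\<infinity>j\<in>{i + k..}. (-s) ^ (j - i - k) * (of_nat (j - i) / of_nat k)
          * of_nat ((j - i + k - 1) choose (2 * k - 1))
          * (q ^ (i * (i + 1) div 2 + j * (j + 1) div 2) / (qpoch q q i * qpoch q q j))) \<and>
     macmahon_C_term s q summable_on increasing_tuples k \<and>
     (\<lambda>(i, j). (-s) ^ (j - i - k) * (of_nat (j - i) / of_nat k)
          * of_nat ((j - i + k - 1) choose (2 * k - 1))
          * (q ^ (i\<^sup>2 + j\<^sup>2) / (qpoch (q\<^sup>2) (q\<^sup>2) i * qpoch (q\<^sup>2) (q\<^sup>2) j)))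
       summable_on (SIGMA i:UNIV. {i + k..}) \<and>
     macmahon_C s k q = 1 / (qpoch_inf (s * q) (q\<^sup>2))\<^sup>2 *
       (\<Sum>\<^sub>\<infinity>i. \<Sum>\<^sub>\<infinity>j\<in>{i + k..}. (-s) ^ (j - i - k) * (of_nat (j - i) / of_nat k)
          * of_nat ((j - i + k - 1) choose (2 * k - 1))
          * (q ^ (i\<^sup>2 + j\<^sup>2) / (qpoch (q\<^sup>2) (q\<^sup>2) i * qpoch (q\<^sup>2) (q\<^sup>2) j)))"
proof -
  have q2: "norm (q\<^sup>2) < 1"
    using assms(1) by (simp add: norm_power power_less_one_iff)
  have EA: "q ^ i * q ^ (i * (i - 1) div 2) = q ^ (i * (i + 1) div 2)" for i
  proof -
    have "i * (i + 1) = i * (i - 1) + i * 2" by (cases i) auto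
    then have "i * (i + 1) div 2 = i + i * (i - 1) div 2" by simp
    then show ?thesis by (simp only: power_add)
  qed
  have EC: "q ^ i * (q\<^sup>2) ^ (i * (i - 1) div 2) = q ^ i\<^sup>2" for i
  proof -
    have "2 * (i * (i - 1) div 2) = i * (i - 1)" by (intro dvd_mult_div_cancel) (cases i; simp)
    moreover have "i + i * (i - 1) = i\<^sup>2" by (cases i) (auto simp: power2_eq_square)
    ultimately show ?thesis by (simp flip: power_mult power_add)
  qed
  note A = macmahon_geometric[OF assms(3,2,1,1)]
  note C = macmahon_geometric[OF assms(3,2,1) q2]
  note TA = infsum_increasing_tuples[of "macmahon_A_term s q", OF macmahon_A_term_eq_prod_list]
  note TC = infsum_increasing_tuples[of "macmahon_C_term s q", OF macmahon_C_term_eq_prod_list]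
  show ?thesis
    \<comment> \<open>The product \<open>E i * E j\<close> is merged into one fraction, in which
      \<open>EA\<close> and \<open>EC\<close> produce the exponents of the statement.\<close>
    unfolding macmahon_A_def macmahon_C_def TA TC
    using A C unfolding pair_coeff_def times_divide_times_eq EA EC unfolding power_add[symmetric]
    by blast
qed

end
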